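(* Let $\mathbb{K}$ be a field, $R=\mathbb{K}[x_1,\dots,x_n]$, and $\mathbf{a}\in\mathbb{N}^n$. If $I$ is an $\mathbf{a}$-determined shifted stable ideal of $R$, then the generalized Newton complementary dual $\widehat{I}^{[\mathbf{a}]}$ has linear quotients.
   Context: Shifted stable ideals. A shifted partition $\lambda-\mu=(\lambda_1,\dots,\lambda_h;\mu_1,\dots,\mu_h)$ (with $h\ge1$) consists of integers with $i-1\le\mu_i<\lambda_i$ for $1\le i\le h$. The corresponding shifted quasi-Ferrers diagram is $D_{\lambda-\mu}=\{(i,j)\in\mathbb{Z}_{+}^2\mid 1\le i\le h,\ \mu_i<j\le\lambda_i\}$. It is connected if any two of its points can be joined by a sequence of points of the diagram in which consecutive points lie in the same row or the same column at Euclidean distance $1$; equivalently, for each $1\le i\le h-1$, $\{j\mid\mu_i<j\le\lambda_i\}\cap\{j\mid\mu_{i+1}<j\le\lambda_{i+1}\}\neq\varnothing$. A monomial ideal $I$ of degree $2$ in $R$ is shifted stable if $I=I_{\lambda-\mu}:=(x_ix_j\mid(i,j)\in D_{\lambda-\mu})$ for some connected shifted quasi-Ferrers diagram $D_{\lambda-\mu}$ (with all $\lambda_i\le n$). Duals. $G(I)$ denotes the minimal set of monomial generators of $I$, and $\mathbf{x}^{\mathbf{a}}=\prod_kx_k^{\mathbf{a}(k)}$. $I$ is $\mathbf{a}$-determined if every $f\in G(I)$ divides $\mathbf{x}^{\mathbf{a}}$; then $\widehat{I}^{[\mathbf{a}]}$ is the monomial ideal with $G(\widehat{I}^{[\mathbf{a}]})=\{\mathbf{x}^{\mathbf{a}}/f\mid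 f\in G(I)\}$. A monomial ideal has linear quotients if its minimal monomial generators can be ordered $g_1,\dots,g_\nu$ so that each colon ideal $(g_1,\dots,g_{k-1}):g_k$, $2\le k\le\nu$, is generated by a set of variables. *)

theory Defs
  imports
    "HOL-Library.Poly_Mapping"
    "HOL-Algebra.Ideal"
    "HOL-Algebra.Divisibility"
begin

text \<open>
  Polynomials are finitely supported maps from exponent vectors to coefficients, so the type below
  is a polynomial ring in the variables \<open>x\<^sub>0, x\<^sub>1, x\<^sub>2, \<dots>\<close>.
  The ring \<open>R = K[x\<^sub>1, \<dots>, x\<^sub>n]\<close> is its subring of polynomials in which only
  variables with index in \<open>{1..n}\<close> occur. Ideals, generated ideals and divisibility are always those
  of \<open>R\<close>, not those of the ambient type.
\<close>

type_synonym 'k mpoly = "(nat \<Rightarrow>\<^sub>0 nat) \<Rightarrow>\<^sub>0 'k"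

definition X :: "nat \<Rightarrow> 'k::field mpoly" where
  "X i = Poly_Mapping.single (Poly_Mapping.single i 1) 1"

definition poly_ring :: "nat \<Rightarrow> 'k::field mpoly ring" where
  "poly_ring n =
     \<lparr>carrier = {p. \<forall>m \<in> Poly_Mapping.keys p. Poly_Mapping.keys m \<subseteq> {1..n}},
      monoid.mult = (*), one = 1, zero = 0, add = (+)\<rparr>"

text \<open>\<open>xpow n a\<close> is \<open>x\<^sup>a\<close>; only the values of \<open>a\<close> on \<open>{1..n}\<close> matter.\<close>

definition xpow :: "nat \<Rightarrow> (nat \<Rightarrow> nat) \<Rightarrow> 'k::field mpoly" where
  "xpow n a = (\<Prod>k = 1..n. X k ^ a k)"

definition monomials :: "nat \<Rightarrow> 'k::field mpoly set" where
  "monomials n = range (xpow n)"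

definition monomial_ideal :: "nat \<Rightarrow> 'k::field mpoly set \<Rightarrow> bool" where
  "monomial_ideal n I \<longleftrightarrow> (\<exists>S \<subseteq> monomials n. I = Idl\<^bsub>poly_ring n\<^esub> S)"

definition minimal_monomial_generating_set ::
    "nat \<Rightarrow> 'k::field mpoly set \<Rightarrow> 'k mpoly set \<Rightarrow> bool" where
  "minimal_monomial_generating_set n I S \<longleftrightarrow>
     S \<subseteq> monomials n \<and> Idl\<^bsub>poly_ring n\<^esub> S = I \<and> (\<forall>T. T \<subset> S \<longrightarrow> Idl\<^bsub>poly_ring n\<^esub> T \<noteq> I)"

text \<open>\<open>G(I)\<close>. It exists and is unique for every monomial ideal: \<open>minimal_monomial_generating_set_ex1\<close>.\<close>

definition min_gens :: "nat \<Rightarrow> 'k::field mpoly set \<Rightarrow> 'k mpoly set" where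
  "min_gens n I = (THE S. minimal_monomial_generating_set n I S)"


definition shifted_partition :: "nat \<Rightarrow> (nat \<Rightarrow> nat) \<Rightarrow> (nat \<Rightarrow> nat) \<Rightarrow> bool" where
  "shifted_partition h lam mu \<longleftrightarrow> 1 \<le> h \<and> (\<forall>i \<in> {1..h}. i - 1 \<le> mu i \<and> mu i < lam i)"

definition shifted_diagram :: "nat \<Rightarrow> (nat \<Rightarrow> nat) \<Rightarrow> (nat \<Rightarrow> nat) \<Rightarrow> (nat \<times> nat) set" where
  "shifted_diagram h lam mu = {(i, j). 1 \<le> i \<and> i \<le> h \<and> mu i < j \<and> j \<le> lam i}"

text \<open>Two lattice points in the same row or in the same column, at Euclidean distance \<open>1\<close>.\<close>

fun adjacent :: "nat \<times> nat \<Rightarrow> nat \<times> nat \<Rightarrow> bool" where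
  "adjacent (i, j) (i', j') \<longleftrightarrow>
     (i = i' \<and> \<bar>int j - int j'\<bar> = 1) \<or> (j = j' \<and> \<bar>int i - int i'\<bar> = 1)"

definition connected_diagram :: "(nat \<times> nat) set \<Rightarrow> bool" where
  "connected_diagram D \<longleftrightarrow>
     (\<forall>p \<in> D. \<forall>q \<in> D. (p, q) \<in> {(u, v). u \<in> D \<and> v \<in> D \<and> adjacent u v}\<^sup>*)"

definition shifted_stable :: "nat \<Rightarrow> 'k::field mpoly set \<Rightarrow> bool" where
  "shifted_stable n I \<longleftrightarrow>
     (\<exists>h lam mu. shifted_partition h lam mu \<and> (\<forall>i \<in> {1..h}. lam i \<le> n) \<and>
        connected_diagram (shifted_diagram h lam mu) \<and>
        I = Idl\<^bsub>poly_ring n\<^esub> {X i * X j | i j. (i, j) \<in> shifted_diagram h lam mu})"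


definition determined :: "nat \<Rightarrow> (nat \<Rightarrow> nat) \<Rightarrow> 'k::field mpoly set \<Rightarrow> bool" where
  "determined n a I \<longleftrightarrow> (\<forall>f \<in> min_gens n I. f divides\<^bsub>poly_ring n\<^esub> xpow n a)"

text \<open>The quotients \<open>x\<^sup>a / f\<close> for \<open>f \<in> G(I)\<close>: the elements \<open>g\<close> of \<open>R\<close> with \<open>f g = x\<^sup>a\<close>.\<close>

definition complementary_gens ::
    "nat \<Rightarrow> (nat \<Rightarrow> nat) \<Rightarrow> 'k::field mpoly set \<Rightarrow> 'k mpoly set" where
  "complementary_gens n a I =
     {g \<in> carrier (poly_ring n). \<exists>f \<in> min_gens n I. f * g = xpow n a}"

text \<open>
  The generalized Newton complementary dual. For a monomial ideal that is \<open>a\<close>-determined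
  this description determines it: \<open>newton_dual_ex1\<close>.
\<close>

definition newton_dual ::
    "nat \<Rightarrow> (nat \<Rightarrow> nat) \<Rightarrow> 'k::field mpoly set \<Rightarrow> 'k mpoly set" where
  "newton_dual n a I =
     (THE J. monomial_ideal n J \<and> min_gens n J = complementary_gens n a I)"


definition colon_ideal ::
    "nat \<Rightarrow> 'k::field mpoly set \<Rightarrow> 'k mpoly \<Rightarrow> 'k mpoly set" where
  "colon_ideal n J g = {p \<in> carrier (poly_ring n). p * g \<in> J}"

text \<open>The list \<open>gs\<close> is indexed from \<open>0\<close>, so \<open>take k gs\<close> consists of all generators before \<open>gs ! k\<close>.\<close>

definition has_linear_quotients :: "nat \<Rightarrow> 'k::field mpoly set \<Rightarrow> bool" where
  "has_linear_quotients n I \<longleftrightarrow>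
     monomial_ideal n I \<and>
     (\<exists>gs. distinct gs \<and> set gs = min_gens n I \<and>
        (\<forall>k. 1 \<le> k \<and> k < length gs \<longrightarrow>
           (\<exists>V \<subseteq> {1..n}. colon_ideal n (Idl\<^bsub>poly_ring n\<^esub> set (take k gs)) (gs ! k)
                           = Idl\<^bsub>poly_ring n\<^esub> (X ` V))))"


section \<open>Well-definedness\<close>

lemma carrier_poly_ring [simp]:
    "carrier (poly_ring n) = {p. \<forall>m \<in> Poly_Mapping.keys p. Poly_Mapping.keys m \<subseteq> {1..n}}"
  and mult_poly_ring [simp]: "x \<otimes>\<^bsub>poly_ring n\<^esub> y = x * y"
  and one_poly_ring [simp]: "\<one>\<^bsub>poly_ring n\<^esub> = 1"
  and zero_poly_ring [simp]: "\<zero>\<^bsub>poly_ring n\<^esub> = 0"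
  and add_poly_ring [simp]: "x \<oplus>\<^bsub>poly_ring n\<^esub> y = x + y"
  by (simp_all add: poly_ring_def)

lemma poly_ring_add_closed:
  "x \<in> carrier (poly_ring n) \<Longrightarrow> y \<in> carrier (poly_ring n) \<Longrightarrow> x + y \<in> carrier (poly_ring n)"
  using Poly_Mapping.keys_add[of x y] by auto

lemma keys_uminus: "Poly_Mapping.keys (- x) = Poly_Mapping.keys (x :: 'k::field mpoly)"
  by (auto simp: in_keys_iff)

lemma keys_add_nat:
  "Poly_Mapping.keys (u + v) = Poly_Mapping.keys u \<union> Poly_Mapping.keys (v :: nat \<Rightarrow>\<^sub>0 nat)"
  by (auto simp: in_keys_iff lookup_add)

lemma poly_ring_mult_closed:
  assumes "x \<in> carrier (poly_ring n)" "y \<in> carrier (poly_ring n)"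
  shows "x * y \<in> carrier (poly_ring n)"
proof -
  have "Poly_Mapping.keys m \<subseteq> {1..n}" if "m \<in> Poly_Mapping.keys (x * y)" for m
  proof -
    obtain u v where "m = u + v" "u \<in> Poly_Mapping.keys x" "v \<in> Poly_Mapping.keys y"
      using \<open>m \<in> Poly_Mapping.keys (x * y)\<close> keys_mult[of x y] by auto
    then show ?thesis using assms by (simp add: keys_add_nat)
  qed
  then show ?thesis by simp
qed

lemma cring_poly_ring: "cring (poly_ring n :: 'k::field mpoly ring)"
proof (rule cringI)
  show "abelian_group (poly_ring n :: 'k mpoly ring)"
  proof (rule abelian_groupI)
    fix x y :: "'k mpoly" assume "x \<in> carrier (poly_ring n)" "y \<in> carrier (poly_ring n)"
    then show "x \<oplus>\<^bsub>poly_ring n\<^esub> y \<in> carrier (poly_ring n)"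
      using poly_ring_add_closed[of x n y] by (simp only: add_poly_ring)
  next
    fix x :: "'k mpoly" assume "x \<in> carrier (poly_ring n)"
    then show "\<exists>y\<in>carrier (poly_ring n). y \<oplus>\<^bsub>poly_ring n\<^esub> x = \<zero>\<^bsub>poly_ring n\<^esub>"
      by (intro bexI[of _ "- x"]) (auto simp: keys_uminus)
  qed (auto simp: add_ac)
  show "comm_monoid (poly_ring n :: 'k mpoly ring)"
  proof (rule comm_monoidI)
    fix x y :: "'k mpoly" assume "x \<in> carrier (poly_ring n)" "y \<in> carrier (poly_ring n)"
    then show "x \<otimes>\<^bsub>poly_ring n\<^esub> y \<in> carrier (poly_ring n)"
      using poly_ring_mult_closed[of x n y] by (simp only: mult_poly_ring)
  qed (auto simp: mult_ac)
qed (auto simp: algebra_simps)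

interpretation PR: cring "poly_ring n"
  by (rule cring_poly_ring)

abbreviation xmon :: "(nat \<Rightarrow>\<^sub>0 nat) \<Rightarrow> 'k::field mpoly" where
  "xmon m \<equiv> Poly_Mapping.single m 1"

abbreviation exponents :: "nat \<Rightarrow> (nat \<Rightarrow>\<^sub>0 nat) set" where
  "exponents n \<equiv> {m. Poly_Mapping.keys m \<subseteq> {1..n}}"

lemma mon_mult: "xmon u * xmon v = xmon (u + v)"
  by (simp add: mult_single)

lemma X_power: "X i ^ e = xmon (Poly_Mapping.single i e)"
  by (induction e) (simp_all add: X_def mult_single single_add[symmetric])

lemma xpow_eq: "xpow n a = (xmon (\<Sum>k = 1..n. Poly_Mapping.single k (a k)) :: 'k::field mpoly)"
proof -
  have "(\<Prod>k\<in>A. X k ^ a k) = (xmon (\<Sum>k\<in>A. Poly_Mapping.single k (a k)) :: 'k mpoly)" if "finite A" for A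
    using that by (induction A) (simp_all add: X_power mult_single)
  then show ?thesis by (simp add: xpow_def)
qed

lemma monomials_eq: "monomials n = (xmon ` exponents n :: 'k::field mpoly set)"
proof (intro equalityI subsetI)
  fix p :: "'k mpoly" assume "p \<in> monomials n"
  then obtain a where p: "p = xpow n a" by (auto simp: monomials_def)
  have "(\<Sum>k = 1..n. Poly_Mapping.single k (a k)) \<in> exponents n"
    by (auto simp: in_keys_iff lookup_sum lookup_single when_def split: if_splits)
  then show "p \<in> xmon ` exponents n" by (auto simp: p xpow_eq)
next
  fix p :: "'k mpoly" assume "p \<in> xmon ` exponents n"
  then obtain m where m: "p = xmon m" "m \<in> exponents n" by auto
  have "(\<Sum>k = 1..n. Poly_Mapping.single k (Poly_Mapping.lookup m k)) = m"
  proof (rule poly_mapping_eqI)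
    fix i
    have "i \<notin> {1..n} \<Longrightarrow> Poly_Mapping.lookup m i = 0" using m(2) by (auto simp: in_keys_iff)
    then show "Poly_Mapping.lookup
        (\<Sum>k = 1..n. Poly_Mapping.single k (Poly_Mapping.lookup m k)) i = Poly_Mapping.lookup m i"
      by (auto simp: lookup_sum lookup_single when_def sum.delta)
  qed
  then have "p = xpow n (Poly_Mapping.lookup m)" by (simp add: m xpow_eq)
  then show "p \<in> monomials n" by (auto simp: monomials_def)
qed

lemma mon_inject: "xmon u = (xmon v :: 'k::field mpoly) \<longleftrightarrow> u = v"
proof
  assume "xmon u = (xmon v :: 'k mpoly)"
  then have "Poly_Mapping.keys (xmon u :: 'k mpoly) = Poly_Mapping.keys (xmon v :: 'k mpoly)" by simp
  then show "u = v" by simp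
qed simp

lemma mon_carrier: "(xmon m :: 'k::field mpoly) \<in> carrier (poly_ring n) \<longleftrightarrow> m \<in> exponents n"
  by simp

lemma poly_mapping_sum_single:
  "(p :: 'k::field mpoly) =
     (\<Sum>m\<in>Poly_Mapping.keys p. Poly_Mapping.single m (Poly_Mapping.lookup p m))"
  by (rule poly_mapping_eqI)
     (auto simp: lookup_sum lookup_single when_def sum.delta in_keys_iff)

lemma mem_Idl_monomials:
  fixes p :: "'k::field mpoly"
  assumes A: "A \<subseteq> exponents n"
  shows "p \<in> Idl\<^bsub>poly_ring n\<^esub> (xmon ` A) \<longleftrightarrow>
    p \<in> carrier (poly_ring n) \<and> (\<forall>m \<in> Poly_Mapping.keys p. \<exists>u\<in>A. \<exists>v. m = u + v)"
proof -
  define J :: "'k mpoly set" where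
    "J = {p \<in> carrier (poly_ring n). \<forall>m \<in> Poly_Mapping.keys p. \<exists>u\<in>A. \<exists>v. m = u + v}"
  have sub: "xmon ` A \<subseteq> carrier (poly_ring n)" using A by auto
  have mult: "x * p \<in> J" if "p \<in> J" "x \<in> carrier (poly_ring n)" for p x
  proof -
    have "\<exists>u\<in>A. \<exists>v. m = u + v" if m: "m \<in> Poly_Mapping.keys (x * p)" for m
    proof -
      obtain s t where st: "m = s + t" "s \<in> Poly_Mapping.keys x" "t \<in> Poly_Mapping.keys p"
        using m keys_mult[of x p] by auto
      then obtain u v where uv: "u \<in> A" "t = u + v" using \<open>p \<in> J\<close> by (auto simp: J_def)
      then have "m = u + (s + v)" using st by (simp add: add_ac)
      then show ?thesis using uv by blast
    qed
    then show ?thesis using poly_ring_mult_closed[of x n p] that by (auto simp: J_def)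
  qed
  have "ideal J (poly_ring n)"
  proof (rule idealI)
    show "ring (poly_ring n :: 'k mpoly ring)" by (rule PR.ring_axioms)
    show "subgroup J (add_monoid (poly_ring n))"
    proof (rule group.subgroupI)
      show "Group.group (add_monoid (poly_ring n :: 'k mpoly ring))" by (rule PR.a_group)
      show "J \<subseteq> carrier (add_monoid (poly_ring n))" by (auto simp: J_def)
      show "J \<noteq> {}" by (auto simp: J_def intro!: exI[of _ 0])
      fix p q assume p: "p \<in> J" and q: "q \<in> J"
      show "p \<otimes>\<^bsub>add_monoid (poly_ring n)\<^esub> q \<in> J"
        using p q Poly_Mapping.keys_add[of p q] poly_ring_add_closed[of p n q]
        unfolding J_def by (simp del: carrier_poly_ring) blast
    next
      fix p assume p: "p \<in> J"
      have "\<ominus>\<^bsub>poly_ring n\<^esub> p = - p"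
      proof (rule PR.minus_equality)
        show "- p \<oplus>\<^bsub>poly_ring n\<^esub> p = \<zero>\<^bsub>poly_ring n\<^esub>" by simp
        show "p \<in> carrier (poly_ring n)" using p by (simp add: J_def)
        then show "- p \<in> carrier (poly_ring n)" by (simp add: keys_uminus)
      qed
      moreover have "- p \<in> J" using p by (auto simp: J_def keys_uminus)
      ultimately show "inv\<^bsub>add_monoid (poly_ring n)\<^esub> p \<in> J" by (simp add: a_inv_def)
    qed
  next
    fix p x :: "'k mpoly" assume "p \<in> J" "x \<in> carrier (poly_ring n)"
    then show "x \<otimes>\<^bsub>poly_ring n\<^esub> p \<in> J" "p \<otimes>\<^bsub>poly_ring n\<^esub> x \<in> J"
      using mult[of p x] by (simp_all add: mult.commute)
  qed
  moreover have "xmon ` A \<subseteq> J"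
    using A by (auto simp: J_def intro!: bexI exI[of _ 0])
  ultimately have "Idl\<^bsub>poly_ring n\<^esub> (xmon ` A) \<subseteq> J" by (rule PR.genideal_minimal)
  moreover have "p \<in> Idl\<^bsub>poly_ring n\<^esub> (xmon ` A)" if p: "p \<in> J" for p
  proof -
    let ?I = "Idl\<^bsub>poly_ring n\<^esub> (xmon ` A) :: 'k mpoly set"
    have I: "ideal ?I (poly_ring n)" using sub by (rule PR.genideal_ideal)
    have terms: "Poly_Mapping.single m (Poly_Mapping.lookup p m) \<in> ?I"
      if m: "m \<in> Poly_Mapping.keys p" for m
    proof -
      obtain u v where uv: "u \<in> A" "m = u + v" using p m by (auto simp: J_def)
      have "m \<in> exponents n" using p m by (auto simp: J_def)
      then have v: "Poly_Mapping.single v (Poly_Mapping.lookup p m) \<in> carrier (poly_ring n)"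
        using uv by (simp add: keys_add_nat)
      have "xmon u \<in> ?I" using PR.genideal_self[OF sub] uv by auto
      from ideal.I_l_closed[OF I this v] show ?thesis
        by (simp add: mult_single uv add.commute)
    qed
    have add: "x + y \<in> ?I" if "x \<in> ?I" "y \<in> ?I" for x y
      using additive_subgroup.a_closed[OF ideal.axioms(1)[OF I] that] by simp
    have zero: "0 \<in> ?I"
      using additive_subgroup.zero_closed[OF ideal.axioms(1)[OF I]] by simp
    have "sum f B \<in> ?I" if "finite B" "\<And>b. b \<in> B \<Longrightarrow> f b \<in> ?I"
      for f and B :: "(nat \<Rightarrow>\<^sub>0 nat) set"
      using that
    proof (induction B)
      case empty
      show ?case unfolding sum.empty by (rule zero)
    next
      case (insert b B)
      have "f b + sum f B \<in> ?I" using insert.IH insert.prems by (intro add) blast+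
      then show ?case unfolding sum.insert[OF insert.hyps] .
    qed
    from this[OF finite_keys terms] have "(\<Sum>m\<in>Poly_Mapping.keys p.
        Poly_Mapping.single m (Poly_Mapping.lookup p m)) \<in> ?I" .
    then show ?thesis by (subst poly_mapping_sum_single)
  qed
  ultimately show ?thesis by (auto simp: J_def)
qed

lemma mon_mem_Idl_monomials:
  assumes "A \<subseteq> exponents n" "m \<in> exponents n"
  shows "(xmon m :: 'k::field mpoly) \<in> Idl\<^bsub>poly_ring n\<^esub> (xmon ` A) \<longleftrightarrow> (\<exists>u\<in>A. \<exists>v. m = u + v)"
  using assms by (simp add: mem_Idl_monomials)

lemma exponent_antisym:
  fixes u v w s :: "nat \<Rightarrow>\<^sub>0 nat"
  assumes "u = v + w" "v = u + s"
  shows "u = v"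
proof (rule poly_mapping_eqI)
  fix i
  have "Poly_Mapping.lookup u i = Poly_Mapping.lookup v i + Poly_Mapping.lookup w i"
    "Poly_Mapping.lookup v i = Poly_Mapping.lookup u i + Poly_Mapping.lookup s i"
    using assms by (metis lookup_add)+
  then show "Poly_Mapping.lookup u i = Poly_Mapping.lookup v i" by simp
qed

text \<open>A set of monomials no two of which divide each other is the minimal generating set.\<close>

definition antichain_exp :: "(nat \<Rightarrow>\<^sub>0 nat) set \<Rightarrow> bool" where
  "antichain_exp A \<longleftrightarrow> (\<forall>u\<in>A. \<forall>u'\<in>A. \<forall>v. u = u' + v \<longrightarrow> u = u')"

lemma minimal_monomial_generating_set_iff:
  fixes S :: "'k::field mpoly set"
  assumes A: "A \<subseteq> exponents n" "antichain_exp A"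
  shows "minimal_monomial_generating_set n (Idl\<^bsub>poly_ring n\<^esub> (xmon ` A)) S \<longleftrightarrow> S = xmon ` A"
proof
  assume S: "minimal_monomial_generating_set n (Idl\<^bsub>poly_ring n\<^esub> (xmon ` A)) S"
  then have "S \<subseteq> xmon ` exponents n"
    by (simp add: minimal_monomial_generating_set_def monomials_eq)
  then obtain B where B: "B \<subseteq> exponents n" "S = xmon ` B" by (auto simp: subset_image_iff)
  have eq: "Idl\<^bsub>poly_ring n\<^esub> (xmon ` B) = (Idl\<^bsub>poly_ring n\<^esub> (xmon ` A) :: 'k mpoly set)"
    using S by (simp add: minimal_monomial_generating_set_def B)
  have "A \<subseteq> B"
  proof
    fix u assume u: "u \<in> A"
    then have "xmon u \<in> (Idl\<^bsub>poly_ring n\<^esub> (xmon ` B) :: 'k mpoly set)"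
      unfolding eq using A by (subst mon_mem_Idl_monomials) (auto intro!: bexI exI[of _ 0])
    then obtain b v where b: "b \<in> B" "u = b + v"
      using mon_mem_Idl_monomials[OF B(1)] u A by blast
    then have "xmon b \<in> (Idl\<^bsub>poly_ring n\<^esub> (xmon ` A) :: 'k mpoly set)"
      unfolding eq[symmetric] using B by (subst mon_mem_Idl_monomials) (auto intro!: bexI exI[of _ 0])
    then obtain u' w where u': "u' \<in> A" "b = u' + w"
      using mon_mem_Idl_monomials[OF A(1)] b B by blast
    have "u = u' + (w + v)" using b u' by (simp add: add_ac)
    then have "u = u'" using A(2) u u' unfolding antichain_exp_def by blast
    then have "u = b" using exponent_antisym[OF b(2)] u' by simp
    then show "u \<in> B" using b by simp
  qed
  then have "xmon ` A \<subseteq> S" using B by auto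
  then show "S = xmon ` A"
    using S unfolding minimal_monomial_generating_set_def by blast
next
  assume S: "S = xmon ` A"
  have "Idl\<^bsub>poly_ring n\<^esub> T \<noteq> (Idl\<^bsub>poly_ring n\<^esub> (xmon ` A) :: 'k mpoly set)" if T: "T \<subset> xmon ` A" for T
  proof
    assume eq: "Idl\<^bsub>poly_ring n\<^esub> T = (Idl\<^bsub>poly_ring n\<^esub> (xmon ` A) :: 'k mpoly set)"
    obtain B where B: "B \<subseteq> A" "T = xmon ` B" using T by (auto simp: subset_image_iff psubset_eq)
    then obtain u where u: "u \<in> A" "u \<notin> B" using T by auto
    have B': "B \<subseteq> exponents n" using B A by auto
    have "xmon u \<in> (Idl\<^bsub>poly_ring n\<^esub> (xmon ` B) :: 'k mpoly set)"
      unfolding B(2)[symmetric] eq using A u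
      by (subst mon_mem_Idl_monomials) (auto intro!: bexI exI[of _ 0])
    then obtain b v where b: "b \<in> B" "u = b + v"
      using mon_mem_Idl_monomials[OF B'] u A by blast
    then have "u = b" using A(2) u B unfolding antichain_exp_def by blast
    then show False using b u by simp
  qed
  then show "minimal_monomial_generating_set n (Idl\<^bsub>poly_ring n\<^esub> (xmon ` A)) S"
    unfolding minimal_monomial_generating_set_def S using A by (auto simp: monomials_eq)
qed

lemma min_gens_antichain:
  assumes "A \<subseteq> exponents n" "antichain_exp A"
  shows "min_gens n (Idl\<^bsub>poly_ring n\<^esub> (xmon ` A)) = (xmon ` A :: 'k::field mpoly set)"
  unfolding min_gens_def using minimal_monomial_generating_set_iff[OF assms]
  by (intro the_equality) auto

lemma monomial_ideal_antichain:
  fixes I :: "'k::field mpoly set"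
  assumes "monomial_ideal n I"
  obtains A where "A \<subseteq> exponents n" "antichain_exp A" "I = Idl\<^bsub>poly_ring n\<^esub> (xmon ` A)"
proof -
  obtain S where S: "S \<subseteq> monomials n" "I = Idl\<^bsub>poly_ring n\<^esub> S"
    using assms by (auto simp: monomial_ideal_def)
  then have "S \<subseteq> xmon ` exponents n" by (simp add: monomials_eq)
  then obtain B where B: "B \<subseteq> exponents n" "S = xmon ` B" by (auto simp: subset_image_iff)
  define A where "A = {u \<in> B. \<forall>b\<in>B. \<forall>v. u = b + v \<longrightarrow> u = b}"
  define deg where "deg m = (\<Sum>i = 1..n. Poly_Mapping.lookup m i)" for m :: "nat \<Rightarrow>\<^sub>0 nat"
  have ex: "\<exists>u\<in>A. \<exists>v. m = u + v" if "m \<in> B" for m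
    using that
  proof (induction "deg m" arbitrary: m rule: less_induct)
    case less
    show ?case
    proof (cases "m \<in> A")
      case True
      then show ?thesis by (intro bexI[of _ m] exI[of _ 0]) auto
    next
      case False
      then obtain b v where b: "b \<in> B" "m = b + v" "m \<noteq> b" using less.prems by (auto simp: A_def)
      then have "v \<noteq> 0" by auto
      then obtain i where i: "i \<in> Poly_Mapping.keys v"
        by (metis all_not_in_conv keys_eq_empty)
      have "m \<in> exponents n" using less.prems B by auto
      then have "i \<in> {1..n}" using i b by (auto simp: keys_add_nat)
      moreover have "0 < Poly_Mapping.lookup v i" using i by (simp add: in_keys_iff)
      ultimately have "0 < deg v" unfolding deg_def by (intro sum_pos2) auto
      then have "deg b < deg m" by (simp add: b(2) deg_def lookup_add sum.distrib)
      then obtain u w where "u \<in> A" "b = u + w" using less.hyps b by blast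
      then have "m = u + (w + v)" using b by (simp add: add_ac)
      then show ?thesis using \<open>u \<in> A\<close> by blast
    qed
  qed
  have A: "A \<subseteq> exponents n" "antichain_exp A" "A \<subseteq> B"
    using B by (auto simp: A_def antichain_exp_def)
  have iff: "(\<exists>u\<in>B. \<exists>v. m = u + v) \<longleftrightarrow> (\<exists>u\<in>A. \<exists>v. m = u + v)" for m
  proof
    assume "\<exists>u\<in>B. \<exists>v. m = u + v"
    then obtain b v where b: "b \<in> B" "m = b + v" by blast
    then obtain u w where "u \<in> A" "b = u + w" using ex by blast
    then show "\<exists>u\<in>A. \<exists>v. m = u + v" using b by (auto simp: add.assoc)
  qed (use A in blast)
  have "I = Idl\<^bsub>poly_ring n\<^esub> (xmon ` A)"
    unfolding S(2) B(2)
    by (rule Set.set_eqI) (simp only: mem_Idl_monomials[OF B(1)] mem_Idl_monomials[OF A(1)] iff)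
  then show thesis using that A by blast
qed

theorem minimal_monomial_generating_set_ex1:
  fixes I :: "'k::field mpoly set"
  assumes "monomial_ideal n I"
  shows "\<exists>!S. minimal_monomial_generating_set n I S"
proof -
  obtain A where A: "A \<subseteq> exponents n" "antichain_exp A" "I = Idl\<^bsub>poly_ring n\<^esub> (xmon ` A)"
    using assms by (rule monomial_ideal_antichain)
  then show ?thesis using minimal_monomial_generating_set_iff[OF A(1,2)] by auto
qed

lemma Idl_min_gens:
  assumes "monomial_ideal n (I :: 'k::field mpoly set)"
  shows "Idl\<^bsub>poly_ring n\<^esub> (min_gens n I) = I"
  using theI'[OF minimal_monomial_generating_set_ex1[OF assms]]
  unfolding min_gens_def minimal_monomial_generating_set_def by blast

theorem newton_dual_ex1:
  fixes I :: "'k::field mpoly set"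
  assumes I: "monomial_ideal n I"
  shows "\<exists>!J. monomial_ideal n J \<and> min_gens n J = complementary_gens n a I"
proof -
  obtain A where A: "A \<subseteq> exponents n" "antichain_exp A" "I = Idl\<^bsub>poly_ring n\<^esub> (xmon ` A)"
    using I by (rule monomial_ideal_antichain)
  have G: "min_gens n I = xmon ` A" using min_gens_antichain[OF A(1,2)] A(3) by simp
  define e where "e = (\<Sum>k = 1..n. Poly_Mapping.single k (a k))"
  define B where "B = {v. \<exists>u\<in>A. u + v = e}"
  have "xpow n a \<in> (monomials n :: 'k mpoly set)" by (simp add: monomials_def)
  then have "(xmon e :: 'k mpoly) \<in> xmon ` exponents n"
    by (simp add: monomials_eq xpow_eq e_def)
  then have e: "e \<in> exponents n" by (auto simp: mon_inject)
  have B: "B \<subseteq> exponents n" using e by (auto simp: B_def keys_add_nat)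
  have anti: "antichain_exp B"
    unfolding antichain_exp_def
  proof (intro ballI allI impI)
    fix v v' w assume "v \<in> B" "v' \<in> B" and v: "v = v' + w"
    then obtain u u' where u: "u \<in> A" "u + v = e" "u' \<in> A" "u' + v' = e" by (auto simp: B_def)
    then have "u' + v' = (u + w) + v'" using v by (simp add: add_ac)
    then have u': "u' = u + w" by simp
    then have "u' = u" using A(2) u unfolding antichain_exp_def by blast
    then show "v = v'" using u' v by simp
  qed
  have "g \<in> xmon ` B" if g: "xmon u * g = (xmon e :: 'k mpoly)" "u \<in> A" for g u
  proof -
    have look: "Poly_Mapping.lookup (xmon u * g) (u + m) = Poly_Mapping.lookup g m" for m
    proof -
      have "Poly_Mapping.lookup (xmon u * g) (u + m) =
          Poly_Mapping.lookup (\<Sum>k\<in>Poly_Mapping.keys g.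
            Poly_Mapping.single (u + k) (Poly_Mapping.lookup g k)) (u + m)"
        by (subst poly_mapping_sum_single[of g]) (simp add: sum_distrib_left mult_single)
      then show ?thesis
        by (auto simp: lookup_sum lookup_single when_def sum.delta in_keys_iff)
    qed
    have 1: "Poly_Mapping.lookup g m = (1 when e = u + m)" for m
      using look[of m] g(1) by (simp add: lookup_single)
    have "g \<noteq> 0" using g(1) by (metis keys_eq_empty keys_single mult_zero_right empty_not_insert
          one_neq_zero keys_zero)
    then obtain v where "Poly_Mapping.lookup g v \<noteq> 0"
      by (metis lookup_zero poly_mapping_eqI)
    then have v: "e = u + v" using 1 by (auto simp: when_def split: if_splits)
    have "g = xmon v"
      by (rule poly_mapping_eqI) (auto simp: 1 lookup_single v)
    then show ?thesis using v g(2) by (auto simp: B_def)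
  qed
  then have "complementary_gens n a I \<subseteq> xmon ` B"
    by (auto simp: complementary_gens_def G xpow_eq e_def)
  moreover have "xmon ` B \<subseteq> complementary_gens n a I"
  proof
    fix g :: "'k mpoly" assume "g \<in> xmon ` B"
    then obtain u v where uv: "g = xmon v" "v \<in> B" "u \<in> A" "u + v = e" by (auto simp: B_def)
    then have "xmon u * g = xpow n a" by (simp add: mon_mult xpow_eq e_def)
    moreover have "g \<in> carrier (poly_ring n)" using uv B by auto
    ultimately show "g \<in> complementary_gens n a I"
      unfolding complementary_gens_def G using uv by blast
  qed
  ultimately have C: "complementary_gens n a I = xmon ` B" by blast
  have "monomial_ideal n (Idl\<^bsub>poly_ring n\<^esub> (xmon ` B) :: 'k mpoly set)"
    unfolding monomial_ideal_def monomials_eq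
    by (intro exI[of _ "xmon ` B"] conjI image_mono B refl)
  moreover have "min_gens n (Idl\<^bsub>poly_ring n\<^esub> (xmon ` B)) = (xmon ` B :: 'k mpoly set)"
    using min_gens_antichain[OF B anti] .
  ultimately show ?thesis
    unfolding C
  proof (intro ex1I conjI; (elim conjE)?)
    fix J :: "'k mpoly set" assume "monomial_ideal n J" "min_gens n J = xmon ` B"
    then show "J = Idl\<^bsub>poly_ring n\<^esub> (xmon ` B)" using Idl_min_gens[of n J] by simp
  qed
qed

end

theory Submission
  imports Defs
begin

text \<open>
  For generators \<open>f, f'\<close> of \<open>I\<close>, the colon ideal \<open>(x\<^sup>a/f') : (x\<^sup>a/f)\<close> is generated by
  \<open>f / gcd(f, f')\<close>. Since all generators have degree two, this is a variable if \<open>f \<noteq> f'\<close> share a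
  variable, and \<open>f\<close> itself otherwise. In the second case it is redundant as soon as some generator
  preceding \<open>f\<close> shares a variable with \<open>f\<close>. So any ordering in which every generator but the first
  shares a variable with an earlier one gives linear quotients. Neighbouring points of the diagram
  share a variable, so connectedness provides such an ordering.
\<close>

section \<open>Ordering the points of a connected finite graph\<close>

lemma connected_enumeration:
  assumes "finite D"
    and conn: "\<And>p q. p \<in> D \<Longrightarrow> q \<in> D \<Longrightarrow> (p, q) \<in> {(u, v). u \<in> D \<and> v \<in> D \<and> R u v}\<^sup>*"
  obtains xs where "distinct xs" "set xs = D"
    "\<And>k. 0 < k \<Longrightarrow> k < length xs \<Longrightarrow> \<exists>u\<in>set (take k xs). R u (xs ! k)"
proof -
  \<comment> \<open>The list grows by one point at a time, so the induction is on its length; at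
    length \<open>card D\<close> it exhausts \<open>D\<close>.\<close>
  have "\<exists>xs. distinct xs \<and> set xs \<subseteq> D \<and> length xs = m \<and>
      (\<forall>k. 0 < k \<and> k < length xs \<longrightarrow> (\<exists>u\<in>set (take k xs). R u (xs ! k)))"
    if "m \<le> card D" for m
    using that
  proof (induction m)
    case 0
    show ?case by simp
  next
    case (Suc m)
    then obtain xs where xs: "distinct xs" "set xs \<subseteq> D" "length xs = m"
      and link: "\<And>k. 0 < k \<Longrightarrow> k < length xs \<Longrightarrow> \<exists>u\<in>set (take k xs). R u (xs ! k)"
      by auto
    have "set xs \<noteq> D" using xs Suc.prems distinct_card[of xs] by auto
    then obtain q where q: "q \<in> D" "q \<notin> set xs" using xs by blast
    have "\<exists>v\<in>D. v \<notin> set xs \<and> (xs \<noteq> [] \<longrightarrow> (\<exists>u\<in>set xs. R u v))"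
    proof (cases "xs = []")
      case True
      then show ?thesis using q by auto
    next
      case False
      then have "hd xs \<in> set xs" by simp
      then have "(hd xs, q) \<in> {(u, v). u \<in> D \<and> v \<in> D \<and> R u v}\<^sup>*"
        using conn q xs by blast
      \<comment> \<open>Induction along a path from \<open>hd xs\<close> to \<open>q\<close>: either
        the point reached still lies in \<open>set xs\<close>, or the path has already left this
        set. The point where it first leaves can be appended.\<close>
      then have "q \<in> set xs \<or> (\<exists>v\<in>D. v \<notin> set xs \<and> (\<exists>u\<in>set xs. R u v))"
        by (induction rule: rtrancl_induct) (use \<open>hd xs \<in> set xs\<close> in auto)
      then show ?thesis using q by blast
    qed
    then obtain v where v: "v \<in> D" "v \<notin> set xs" "xs \<noteq> [] \<Longrightarrow> \<exists>u\<in>set xs. R u v" by blast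
    show ?case
    proof (intro exI[of _ "xs @ [v]"] conjI allI impI)
      fix k assume k: "0 < k \<and> k < length (xs @ [v])"
      show "\<exists>u\<in>set (take k (xs @ [v])). R u ((xs @ [v]) ! k)"
      proof (cases "k < length xs")
        case True
        then show ?thesis using link[of k] k by (simp add: nth_append)
      next
        case False
        then have "k = length xs" using k by simp
        then show ?thesis using v(3) k by auto
      qed
    qed (use xs v in auto)
  qed
  from this[OF order_refl] obtain xs where xs: "distinct xs" "set xs \<subseteq> D" "length xs = card D"
    and link: "\<And>k. 0 < k \<Longrightarrow> k < length xs \<Longrightarrow> \<exists>u\<in>set (take k xs). R u (xs ! k)"
    by auto
  have "set xs = D"
    using xs \<open>finite D\<close> by (intro card_subset_eq) (simp_all add: distinct_card)
  then show thesis using that xs link by blast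
qed

section \<open>Colon ideals of monomial ideals by a monomial\<close>

text \<open>Shifting exponents by \<open>v\<close> is injective, so no terms of the product can
  cancel.\<close>

lemma keys_mult_xmon:
  fixes p :: "'k::field mpoly"
  shows "Poly_Mapping.keys (p * xmon v) = (\<lambda>m. m + v) ` Poly_Mapping.keys p"
proof
  show "Poly_Mapping.keys (p * xmon v) \<subseteq> (\<lambda>m. m + v) ` Poly_Mapping.keys p"
    using keys_mult[of p "xmon v"] by auto
next
  have "Poly_Mapping.lookup (p * xmon v) (m + v) = Poly_Mapping.lookup p m" for m
  proof -
    have "Poly_Mapping.lookup (p * xmon v) (m + v) =
        Poly_Mapping.lookup (\<Sum>k\<in>Poly_Mapping.keys p.
          Poly_Mapping.single (k + v) (Poly_Mapping.lookup p k)) (m + v)"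
      by (subst poly_mapping_sum_single[of p]) (simp add: sum_distrib_right mult_single)
    then show ?thesis
      by (auto simp: lookup_sum lookup_single when_def sum.delta in_keys_iff)
  qed
  then show "(\<lambda>m. m + v) ` Poly_Mapping.keys p \<subseteq> Poly_Mapping.keys (p * xmon v)"
    by (auto simp: in_keys_iff)
qed

lemma mem_colon_ideal_monomials:
  fixes p :: "'k::field mpoly"
  assumes "A \<subseteq> exponents n" "v \<in> exponents n"
  shows "p \<in> colon_ideal n (Idl\<^bsub>poly_ring n\<^esub> (xmon ` A)) (xmon v) \<longleftrightarrow>
    p \<in> carrier (poly_ring n) \<and> (\<forall>m\<in>Poly_Mapping.keys p. \<exists>u\<in>A. \<exists>w. m + v = u + w)"
  unfolding colon_ideal_def mem_Idl_monomials[OF assms(1)]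
  using assms(2) by (auto simp: keys_mult_xmon keys_add_nat)

lemma X_image_eq: "X ` V = xmon ` (\<lambda>i. Poly_Mapping.single i 1) ` V"
  by (auto simp: X_def)

lemma in_keys_iff_single_add:
  fixes m :: "nat \<Rightarrow>\<^sub>0 nat"
  shows "i \<in> Poly_Mapping.keys m \<longleftrightarrow> (\<exists>w. m = Poly_Mapping.single i 1 + w)"
proof
  assume "i \<in> Poly_Mapping.keys m"
  \<comment> \<open>The subtraction is truncated, but loses nothing because the exponent of
    \<open>m\<close> at \<open>i\<close> is positive.\<close>
  then have "m = Poly_Mapping.single i 1 + (m - Poly_Mapping.single i 1)"
    by (intro poly_mapping_eqI) (auto simp: lookup_add lookup_minus lookup_single when_def in_keys_iff)
  then show "\<exists>w. m = Poly_Mapping.single i 1 + w" ..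
qed (auto simp: keys_add_nat)

text \<open>Both ideals are monomial, so it suffices to compare the monomials in them. By
  \<open>lin\<close>, every monomial in the colon ideal is divisible by a variable that lies in the
  colon ideal itself.\<close>

lemma colon_ideal_generated_by_variables:
  assumes A: "A \<subseteq> exponents n" and v: "v \<in> exponents n"
    and lin: "\<And>u m w. u \<in> A \<Longrightarrow> m + v = u + w \<Longrightarrow>
      \<exists>i\<in>Poly_Mapping.keys m. \<exists>u'\<in>A. \<exists>w'. Poly_Mapping.single i 1 + v = u' + w'"
  shows "\<exists>V\<subseteq>{1..n}. colon_ideal n (Idl\<^bsub>poly_ring n\<^esub> (xmon ` A)) (xmon v) =
    (Idl\<^bsub>poly_ring n\<^esub> (X ` V) :: 'k::field mpoly set)"
proof -
  \<comment> \<open>All variables that lie in the colon ideal; with this choice only one inclusion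
    depends on \<open>lin\<close>.\<close>
  define V where "V = {i \<in> {1..n}. \<exists>u\<in>A. \<exists>w. Poly_Mapping.single i 1 + v = u + w}"
  have E: "(\<lambda>i. Poly_Mapping.single i 1) ` V \<subseteq> exponents n" by (auto simp: V_def)
  have iff: "(\<exists>u\<in>A. \<exists>w. m + v = u + w) \<longleftrightarrow> (\<exists>i\<in>V. \<exists>w. m = Poly_Mapping.single i 1 + w)"
    if m: "m \<in> exponents n" for m
  proof
    assume "\<exists>u\<in>A. \<exists>w. m + v = u + w"
    then obtain i where "i \<in> Poly_Mapping.keys m" "\<exists>u\<in>A. \<exists>w. Poly_Mapping.single i 1 + v = u + w"
      using lin by blast
    moreover from this have "i \<in> V" using m by (auto simp: V_def)
    ultimately show "\<exists>i\<in>V. \<exists>w. m = Poly_Mapping.single i 1 + w"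
      unfolding in_keys_iff_single_add by blast
  next
    assume "\<exists>i\<in>V. \<exists>w. m = Poly_Mapping.single i 1 + w"
    then obtain i w u w' where "m = Poly_Mapping.single i 1 + w" "u \<in> A"
      "Poly_Mapping.single i 1 + v = u + w'" by (auto simp: V_def)
    then have "m + v = u + (w' + w)" by (metis add.assoc add.commute)
    then show "\<exists>u\<in>A. \<exists>w. m + v = u + w" using \<open>u \<in> A\<close> by blast
  qed
  have "p \<in> colon_ideal n (Idl\<^bsub>poly_ring n\<^esub> (xmon ` A)) (xmon v) \<longleftrightarrow>
      p \<in> Idl\<^bsub>poly_ring n\<^esub> (X ` V)" for p :: "'k mpoly"
    unfolding X_image_eq mem_colon_ideal_monomials[OF A v] mem_Idl_monomials[OF E]
    using iff by auto
  then show ?thesis by (intro exI[of _ V]) (auto simp: V_def)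
qed

section \<open>Monomials of degree two\<close>

text \<open>Points are viewed as edges of a graph on the variables, a square being a loop;
  generators share a variable when their edges meet.\<close>

definition edge :: "nat \<times> nat \<Rightarrow> nat \<Rightarrow>\<^sub>0 nat" where
  "edge p = Poly_Mapping.single (fst p) 1 + Poly_Mapping.single (snd p) 1"

lemma X_mult_X: "X i * X j = xmon (edge (i, j))"
  by (simp add: X_def edge_def mult_single)

lemma keys_edge: "Poly_Mapping.keys (edge p) = {fst p, snd p}"
  by (auto simp: edge_def keys_add_nat)

text \<open>The monomial forgets the order of its two indices; the inequalities restore it.\<close>

lemma edge_inject:
  assumes "edge p = edge q" "fst p \<le> snd p" "fst q \<le> snd q"
  shows "p = q"
proof -
  have "{fst p, snd p} = {fst q, snd q}" using assms(1) by (metis keys_edge)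
  then show ?thesis using assms(2,3) by (auto simp: doubleton_eq_iff prod_eq_iff)
qed

text \<open>All these monomials have degree two, so the quotient of one by another has degree
  zero.\<close>

lemma antichain_exp_edges: "antichain_exp (edge ` D)"
  unfolding antichain_exp_def
proof (intro ballI allI impI)
  fix f f' v assume "f \<in> edge ` D" "f' \<in> edge ` D" and f: "f = f' + v"
  then obtain p q where pq: "f = edge p" "f' = edge q" by blast
  \<comment> \<open>This finite set contains the keys of \<open>f\<close>, \<open>f'\<close> and
    \<open>v\<close>, so all three degrees are sums over it.\<close>
  let ?K = "Poly_Mapping.keys f"
  have deg: "(\<Sum>i\<in>?K. Poly_Mapping.lookup (edge r) i) = 2" if "Poly_Mapping.keys (edge r) \<subseteq> ?K" for r
  proof -
    have "fst r \<in> ?K" "snd r \<in> ?K" using that by (simp_all add: keys_edge)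
    then show ?thesis by (simp add: edge_def lookup_add sum.distrib lookup_single when_def)
  qed
  have "(\<Sum>i\<in>?K. Poly_Mapping.lookup f i) =
      (\<Sum>i\<in>?K. Poly_Mapping.lookup f' i) + (\<Sum>i\<in>?K. Poly_Mapping.lookup v i)"
    by (simp add: f lookup_add sum.distrib)
  moreover have "Poly_Mapping.keys f' \<subseteq> ?K" by (simp add: f keys_add_nat)
  ultimately have "(\<Sum>i\<in>?K. Poly_Mapping.lookup v i) = 0"
    using deg[of p] deg[of q] pq by simp
  moreover have "Poly_Mapping.keys v \<subseteq> ?K" by (simp add: f keys_add_nat)
  ultimately have "i \<notin> Poly_Mapping.keys v" for i
    unfolding sum_eq_0_iff[OF finite_keys] by (meson in_keys_iff subsetD)
  then have "v = 0" by (metis all_not_in_conv keys_eq_empty)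
  then show "f = f'" using f by simp
qed

lemma edge_shared_variable:
  assumes "Poly_Mapping.keys (edge p) \<inter> Poly_Mapping.keys (edge q) \<noteq> {}"
  obtains c i j where "edge p = Poly_Mapping.single c 1 + Poly_Mapping.single i 1"
    "edge q = Poly_Mapping.single c 1 + Poly_Mapping.single j 1"
proof -
  have split: "\<exists>i. edge r = Poly_Mapping.single c 1 + Poly_Mapping.single i 1"
    if "c \<in> Poly_Mapping.keys (edge r)" for r c
    using that unfolding keys_edge unfolding edge_def by (auto intro: add.commute)
  show thesis using assms split that by blast
qed

text \<open>The linearity of the colon ideals, expressed through the generators of \<open>I\<close>
  instead of their complements. Here \<open>edge q\<close> is the current generator,
  \<open>F\<close> holds the earlier ones, and \<open>edge p\<close> is an earlier one that meets
  \<open>edge q\<close>. The equation \<open>eq\<close> says that \<open>m\<close> times the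
  complement of \<open>edge q\<close> is divisible by the complement of \<open>f\<close>.\<close>

lemma edge_colon_linear:
  assumes "edge p \<in> F" and F: "F \<subseteq> range edge" and "f \<in> F" "f \<noteq> edge q"
    and eq: "f + m = edge q + w"
    and share: "Poly_Mapping.keys (edge p) \<inter> Poly_Mapping.keys (edge q) \<noteq> {}"
  shows "\<exists>i\<in>Poly_Mapping.keys m. \<exists>f\<in>F. \<exists>w. f + Poly_Mapping.single i 1 = edge q + w"
proof (cases "Poly_Mapping.keys f \<inter> Poly_Mapping.keys (edge q) = {}")
  case False
  obtain r where r: "f = edge r" using F \<open>f \<in> F\<close> by blast
  obtain c i j where c: "edge r = Poly_Mapping.single c 1 + Poly_Mapping.single i 1"
    "edge q = Poly_Mapping.single c 1 + Poly_Mapping.single j 1"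
    using False unfolding r by (rule edge_shared_variable)
  \<comment> \<open>After cancelling \<open>c\<close>, the variable \<open>j\<close> divides
    \<open>i\<close> times \<open>m\<close>; as it differs from \<open>i\<close>, it must come from
    \<open>m\<close>. Then \<open>f\<close> itself is the witness.\<close>
  have "i \<noteq> j" using \<open>f \<noteq> edge q\<close> r c by auto
  moreover have "Poly_Mapping.single i 1 + m = Poly_Mapping.single j 1 + w"
    using eq unfolding r c by (simp add: add.assoc)
  then have "j \<in> Poly_Mapping.keys (Poly_Mapping.single i (1::nat) + m)" by (simp add: keys_add_nat)
  ultimately have "j \<in> Poly_Mapping.keys m" by (simp add: keys_add_nat)
  moreover have "f + Poly_Mapping.single j 1 = edge q + Poly_Mapping.single i 1"
    unfolding r c by (simp add: add_ac)
  ultimately show ?thesis using \<open>f \<in> F\<close> by blast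
next
  case True
  \<comment> \<open>Now \<open>f\<close> and \<open>edge q\<close> are coprime, so every variable of
    \<open>edge q\<close> occurs in \<open>m\<close>. The one left after splitting off a variable
    shared with \<open>edge p\<close> will do, with \<open>edge p\<close> replacing \<open>f\<close>
    as the witness.\<close>
  obtain c i j where c: "edge p = Poly_Mapping.single c 1 + Poly_Mapping.single i 1"
    "edge q = Poly_Mapping.single c 1 + Poly_Mapping.single j 1"
    using share by (rule edge_shared_variable)
  have "j \<in> Poly_Mapping.keys (edge q)" unfolding c by (simp add: keys_add_nat)
  moreover from this have "j \<in> Poly_Mapping.keys (f + m)" unfolding eq by (simp add: keys_add_nat)
  ultimately have "j \<in> Poly_Mapping.keys m" using True by (auto simp: keys_add_nat)
  moreover have "edge p + Poly_Mapping.single j 1 = edge q + Poly_Mapping.single i 1"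
    unfolding c by (simp add: add_ac)
  ultimately show ?thesis using \<open>edge p \<in> F\<close> by blast
qed

section \<open>Generators of the complementary dual\<close>

text \<open>The key \<open>e\<close> of the product comes from some key \<open>v\<close> of
  \<open>g\<close>; cancelling the nonzero factor \<open>xmon f\<close> then identifies
  \<open>g\<close>.\<close>

lemma xmon_dvd_xmon:
  fixes g :: "'k::field mpoly"
  assumes "xmon f * g = xmon e"
  obtains v where "g = xmon v" "f + v = e"
proof -
  have "e \<in> Poly_Mapping.keys (g * xmon f)" using assms by (simp add: mult.commute)
  then obtain v where v: "f + v = e" by (auto simp: keys_mult_xmon add.commute)
  then have "xmon f * g = xmon f * xmon v" using assms by (simp add: mon_mult)
  moreover have "xmon f \<noteq> (0 :: 'k mpoly)" by (metis keys_single keys_zero empty_not_insert one_neq_zero)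
  ultimately have "g = xmon v" by simp
  then show thesis using v that by blast
qed

text \<open>Determinedness bounds each \<open>f\<close> by \<open>e\<close>, so the truncated
  difference \<open>e - f\<close> is the exponent of the true quotient.\<close>

lemma complementary_gens_eq:
  fixes I :: "'k::field mpoly set"
  assumes G: "min_gens n I = xmon ` A" and e: "xpow n a = (xmon e :: 'k mpoly)"
    and E: "e \<in> exponents n" and det: "determined n a I"
  shows "complementary_gens n a I = (\<lambda>f. xmon (e - f)) ` A"
    and "\<And>f. f \<in> A \<Longrightarrow> f + (e - f) = e"
proof -
  show compl: "f + (e - f) = e" if "f \<in> A" for f
  proof -
    have "(xmon f :: 'k mpoly) divides\<^bsub>poly_ring n\<^esub> xmon e"
      using det G that unfolding determined_def e by blast
    then obtain g where "xmon e = xmon f * (g :: 'k mpoly)"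
      unfolding factor_def mult_poly_ring by blast
    from this[symmetric] obtain v where "f + v = e" by (rule xmon_dvd_xmon)
    then show ?thesis by auto
  qed
  show "complementary_gens n a I = (\<lambda>f. xmon (e - f)) ` A"
  proof (intro equalityI subsetI)
    fix g assume "g \<in> complementary_gens n a I"
    then obtain f where f: "f \<in> A" "xmon f * g = xmon e"
      unfolding complementary_gens_def G e by blast
    from f(2) obtain v where "g = xmon v" "f + v = e" by (rule xmon_dvd_xmon)
    then show "g \<in> (\<lambda>f. xmon (e - f)) ` A" using f(1) by force
  next
    fix g :: "'k mpoly" assume "g \<in> (\<lambda>f. xmon (e - f)) ` A"
    then obtain f where f: "f \<in> A" "g = xmon (e - f)" by blast
    have "xmon f * g = xmon e" using compl f by (simp add: mon_mult)
    moreover have "e - f \<in> exponents n"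
      using compl[OF f(1)] E keys_add_nat[of f "e - f"] by auto
    then have "g \<in> carrier (poly_ring n)" using f by simp
    ultimately show "g \<in> complementary_gens n a I"
      unfolding complementary_gens_def G e using f(1) by blast
  qed
qed

section \<open>Linear quotients of the dual\<close>

text \<open>The shape of the diagram enters only through connectedness by shared variables and
  through \<open>i \<le> j\<close>, which makes \<open>edge\<close> injective on
  \<open>D\<close>.\<close>

theorem newton_dual_linear_quotients:
  fixes I :: "'k::field mpoly set"
  assumes I: "I = Idl\<^bsub>poly_ring n\<^esub> (xmon ` edge ` D)"
    and D: "D \<subseteq> {(i, j). 1 \<le> i \<and> i \<le> j \<and> j \<le> n}"
    and conn: "\<And>p q. p \<in> D \<Longrightarrow> q \<in> D \<Longrightarrow> (p, q) \<in> {(u, v). u \<in> D \<and> v \<in> D \<and>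
        Poly_Mapping.keys (edge u) \<inter> Poly_Mapping.keys (edge v) \<noteq> {}}\<^sup>*"
    and det: "determined n a I"
  shows "has_linear_quotients n (newton_dual n a I)"
proof -
  have "D \<subseteq> {1..n} \<times> {1..n}" using D by auto
  then have "finite D" by (rule finite_subset) simp
  then obtain ps where ps: "distinct ps" "set ps = D"
    and link: "\<And>k. 0 < k \<Longrightarrow> k < length ps \<Longrightarrow>
      \<exists>u\<in>set (take k ps). Poly_Mapping.keys (edge u) \<inter> Poly_Mapping.keys (edge (ps ! k)) \<noteq> {}"
    by (rule connected_enumeration[OF _ conn]) auto
  have A: "edge ` D \<subseteq> exponents n" using D by (force simp: keys_edge)
  have mI: "monomial_ideal n I"
    unfolding monomial_ideal_def monomials_eq I
    by (intro exI[of _ "xmon ` edge ` D"] conjI image_mono A refl)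
  have "xpow n a \<in> (monomials n :: 'k mpoly set)" by (simp add: monomials_def)
  then obtain e where E: "e \<in> exponents n" and e: "xpow n a = (xmon e :: 'k mpoly)"
    unfolding monomials_eq by blast
  have G: "min_gens n I = xmon ` edge ` D"
    unfolding I by (rule min_gens_antichain[OF A antichain_exp_edges])
  note compl = complementary_gens_eq(2)[OF G e E det]
  have J: "monomial_ideal n (newton_dual n a I)"
    "min_gens n (newton_dual n a I) = (\<lambda>f. xmon (e - f)) ` edge ` D"
    using theI'[OF newton_dual_ex1[OF mI, of a]] complementary_gens_eq(1)[OF G e E det]
    unfolding newton_dual_def by auto
  \<comment> \<open>The exponent of the generator complementary to \<open>edge p\<close>; the
    generators of the dual are listed in the order of the points in \<open>ps\<close>.\<close>
  define c where "c p = e - edge p" for p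
  have c: "edge p + c p = e" if "p \<in> D" for p using compl that by (simp add: c_def)
  have c_exp: "c p \<in> exponents n" if "p \<in> D" for p
    using c[OF that] E keys_add_nat[of "edge p" "c p"] by auto
  have inj: "inj_on c D"
  proof (rule inj_onI)
    fix p q assume pq: "p \<in> D" "q \<in> D" "c p = c q"
    then have "edge p = edge q" using c by (metis add_right_cancel)
    then show "p = q" using pq D by (intro edge_inject) auto
  qed
  define gs :: "'k mpoly list" where "gs = map (\<lambda>p. xmon (c p)) ps"
  have "distinct gs"
    using ps inj by (auto simp: gs_def distinct_map inj_on_def mon_inject)
  moreover have "set gs = min_gens n (newton_dual n a I)"
    by (auto simp: gs_def J c_def ps)
  moreover have "\<exists>V\<subseteq>{1..n}. colon_ideal n (Idl\<^bsub>poly_ring n\<^esub> set (take k gs)) (gs ! k) =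
      Idl\<^bsub>poly_ring n\<^esub> (X ` V)" if k: "1 \<le> k" "k < length gs" for k
  proof -
    define q where "q = ps ! k"
    define P where "P = set (take k ps)"
    have kp: "k < length ps" using k by (simp add: gs_def)
    have q: "q \<in> D" "gs ! k = xmon (c q)" using kp ps by (auto simp: q_def gs_def)
    have P: "P \<subseteq> D" unfolding P_def using ps by (auto dest: in_set_takeD)
    have "q \<notin> P" unfolding P_def q_def using ps(1) kp
      by (auto simp: in_set_conv_nth nth_eq_iff_index_eq)
    obtain p where p: "p \<in> P" "Poly_Mapping.keys (edge p) \<inter> Poly_Mapping.keys (edge q) \<noteq> {}"
      using link[of k] k kp unfolding P_def q_def by auto
    have "set (take k gs) = xmon ` c ` P" by (simp add: gs_def P_def take_map image_image)
    moreover have "\<exists>V\<subseteq>{1..n}. colon_ideal n (Idl\<^bsub>poly_ring n\<^esub> (xmon ` c ` P)) (xmon (c q)) =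
        (Idl\<^bsub>poly_ring n\<^esub> (X ` V) :: 'k mpoly set)"
    proof (rule colon_ideal_generated_by_variables)
      \<comment> \<open>Adding \<open>edge q + edge r\<close> to both sides completes each
        complement to \<open>e\<close>, which cancels. This passes from complements to generators of
        \<open>I\<close>.\<close>
      have exchange: "m + c q = c r + w \<longleftrightarrow> edge r + m = edge q + w" if "r \<in> P" for r m w
      proof -
        have "m + c q = c r + w \<longleftrightarrow> (edge q + edge r) + (m + c q) = (edge q + edge r) + (c r + w)"
          by simp
        also have "(edge q + edge r) + (m + c q) = e + (edge r + m)"
          by (simp add: add_ac flip: c[OF q(1)])
        also have "(edge q + edge r) + (c r + w) = e + (edge q + w)"
          using c[of r] P that by (metis add.assoc add.commute subsetD)
        finally show ?thesis by simp
      qed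
      fix u m w assume "u \<in> c ` P" and eq: "m + c q = u + w"
      then obtain r where r: "r \<in> P" "u = c r" by blast
      have "r \<noteq> q" using r \<open>q \<notin> P\<close> by blast
      then have "edge r \<noteq> edge q" using r P q D by (auto dest!: edge_inject)
      moreover have "edge r + m = edge q + w" using eq r exchange by blast
      ultimately have "\<exists>i\<in>Poly_Mapping.keys m. \<exists>f\<in>edge ` P. \<exists>w.
          f + Poly_Mapping.single i 1 = edge q + w"
        using p r by (intro edge_colon_linear[of p _ "edge r" q m w]) auto
      \<comment> \<open>\<open>exchange\<close> is read backwards here, with a single variable in
        place of \<open>m\<close>.\<close>
      then show "\<exists>i\<in>Poly_Mapping.keys m. \<exists>u'\<in>c ` P. \<exists>w'. Poly_Mapping.single i 1 + c q = u' + w'"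
        using exchange by blast
    qed (use P c_exp q in auto)
    ultimately show ?thesis using q by simp
  qed
  ultimately show ?thesis
    unfolding has_linear_quotients_def using J(1) by blast
qed

section \<open>Application to shifted stable ideals\<close>

theorem proposition6p5:
  fixes n :: nat and a :: "nat \<Rightarrow> nat" and I :: "'k::field mpoly set"
  assumes "shifted_stable n I"
    and "determined n a I"
  shows "has_linear_quotients n (newton_dual n a I)"
proof -
  obtain h lam mu where sp: "shifted_partition h lam mu" and lam: "\<forall>i\<in>{1..h}. lam i \<le> n"
    and conn: "connected_diagram (shifted_diagram h lam mu)"
    and I: "I = Idl\<^bsub>poly_ring n\<^esub> {X i * X j | i j. (i, j) \<in> shifted_diagram h lam mu}"
    using assms(1) unfolding shifted_stable_def by blast
  define D where "D = shifted_diagram h lam mu"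
  have "{X i * X j | i j. (i, j) \<in> D} = (xmon ` edge ` D :: 'k mpoly set)"
    unfolding X_mult_X by (force simp: image_iff)
  then have I: "I = Idl\<^bsub>poly_ring n\<^esub> (xmon ` edge ` D)" using I by (simp add: D_def)
  \<comment> \<open>The bound \<open>i - 1 \<le> mu i\<close> of a shifted partition, together with
    \<open>mu i < j\<close>, places the diagram on or above the diagonal.\<close>
  have D: "D \<subseteq> {(i, j). 1 \<le> i \<and> i \<le> j \<and> j \<le> n}"
  proof clarify
    fix i j assume "(i, j) \<in> D"
    then have ij: "i \<in> {1..h}" "mu i < j" "j \<le> lam i" by (auto simp: D_def shifted_diagram_def)
    then have "i - 1 \<le> mu i" "lam i \<le> n" using sp lam by (auto simp: shifted_partition_def)
    then show "1 \<le> i \<and> i \<le> j \<and> j \<le> n" using ij by auto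
  qed
  \<comment> \<open>Adjacent points agree in a row or column index, which is an index of a common
    variable; hence paths in the diagram are paths through shared variables.\<close>
  have "{(u, v). u \<in> D \<and> v \<in> D \<and> adjacent u v} \<subseteq>
      {(u, v). u \<in> D \<and> v \<in> D \<and> Poly_Mapping.keys (edge u) \<inter> Poly_Mapping.keys (edge v) \<noteq> {}}"
    by (auto simp: keys_edge)
  then have sub: "{(u, v). u \<in> D \<and> v \<in> D \<and> adjacent u v}\<^sup>* \<subseteq>
      {(u, v). u \<in> D \<and> v \<in> D \<and> Poly_Mapping.keys (edge u) \<inter> Poly_Mapping.keys (edge v) \<noteq> {}}\<^sup>*"
    by (rule rtrancl_mono)
  show ?thesis
  proof (rule newton_dual_linear_quotients[OF I D _ assms(2)])
    fix p q assume "p \<in> D" "q \<in> D"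
    then have "(p, q) \<in> {(u, v). u \<in> D \<and> v \<in> D \<and> adjacent u v}\<^sup>*"
      using conn unfolding connected_diagram_def D_def by blast
    then show "(p, q) \<in> {(u, v). u \<in> D \<and> v \<in> D \<and>
        Poly_Mapping.keys (edge u) \<inter> Poly_Mapping.keys (edge v) \<noteq> {}}\<^sup>*"
      using sub by blast
  qed
qed

end
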